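(* For any finite group $G$, the group $K=\mathcal{G}(\partial\mathcal{C}_I(G))$ generated by the dual of the identity Cayley machine of $G$ is isomorphic to $G$. Moreover, for every nonempty word $g\in G^{*}$ (a word over the alphabet $G$), the stabilizer $\mathrm{Stab}_K(g)$ is trivial.
   Context: A transducer has a finite state set $Q$, a finite alphabet $A$, and for each state $q$ and letter $a$ exactly one edge $q\xrightarrow{a|b}p$ (input $a$, output $b$, next state $p$). Each state $q$ acts on $A^*$: on $a_1\ldots a_n$ it outputs $b$ where $q\xrightarrow{a_1|b}p$, and then $p$ acts on $a_2\ldots a_n$. The transducer is invertible if each state induces a permutation $a\mapsto b$ of $A$; then the states generate a group $\mathcal{G}$ of automorphisms of the rooted tree $A^*$. The dual $\partial\mathcal{A}$ has states $A$, alphabet $Q$, and an edge $a\xrightarrow{p|q}b$ for each edge $p\xrightarrow{a|b}q$ of $\mathcal{A}$. The identity Cayley machine $\mathcal{C}_I(G)$ has states $G$, alphabet $G$ and edges $g\xrightarrow{x|x}gx$ for all $g,x\in G$; thus $\partial\mathcal{C}_I(G)$ has states $G$, alphabet $G$ and edges $x\xrightarrow{g|gx}x$. *)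

theory Defs
  imports
    "HOL-Algebra.Elementary_Groups"
    "HOL-Algebra.Group_Action"
    "HOL-Algebra.Bij"
    "HOL-Library.Sublist"
begin

section \<open>Transducers\<close>

text \<open>
  The functions \<open>out\<close> and \<open>nxt\<close> encode the edge relation: the unique edge with source \<open>q\<close> and
  input letter \<open>a\<close> carries the output letter \<open>out T q a\<close> and ends in \<open>nxt T q a\<close>. Their values
  are relevant only for \<open>q \<in> states T\<close> and \<open>a \<in> alphabet T\<close>.
\<close>

record ('q, 'a) transducer =
  states :: "'q set"
  alphabet :: "'a set"
  out :: "'q \<Rightarrow> 'a \<Rightarrow> 'a"
  nxt :: "'q \<Rightarrow> 'a \<Rightarrow> 'q"

locale finite_transducer =
  fixes T :: "('q, 'a) transducer"
  assumes finite_states: "finite (states T)"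
    and finite_alphabet: "finite (alphabet T)"
    and out_closed: "q \<in> states T \<Longrightarrow> a \<in> alphabet T \<Longrightarrow> out T q a \<in> alphabet T"
    and nxt_closed: "q \<in> states T \<Longrightarrow> a \<in> alphabet T \<Longrightarrow> nxt T q a \<in> states T"

locale invertible_transducer = finite_transducer +
  assumes out_bij: "q \<in> states T \<Longrightarrow> bij_betw (out T q) (alphabet T) (alphabet T)"

primrec transduce :: "('q, 'a) transducer \<Rightarrow> 'q \<Rightarrow> 'a list \<Rightarrow> 'a list" where
  "transduce T q [] = []"
| "transduce T q (a # w) = out T q a # transduce T (nxt T q a) w"

section \<open>The automorphism group of the rooted tree of words\<close>

text \<open>
  The rooted tree over \<open>A\<close> has the words over \<open>A\<close> as vertices and the empty word as root; \<open>u\<close> is an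
  ancestor of \<open>v\<close> iff \<open>u\<close> is a prefix of \<open>v\<close>. Its automorphisms are the bijections that preserve
  and reflect this relation, taken as extensional functions as in \<^const>\<open>Bij\<close>.
\<close>

definition tree_auto :: "'a set \<Rightarrow> ('a list \<Rightarrow> 'a list) set" where
  "tree_auto A = {f \<in> Bij (lists A). \<forall>u\<in>lists A. \<forall>v\<in>lists A. prefix (f u) (f v) \<longleftrightarrow> prefix u v}"

definition Tree_AutoGroup :: "'a set \<Rightarrow> ('a list \<Rightarrow> 'a list) monoid" where
  "Tree_AutoGroup A = BijGroup (lists A) \<lparr>carrier := tree_auto A\<rparr>"

lemma subgroup_tree_auto: "subgroup (tree_auto A) (BijGroup (lists A))"
proof (rule subgroup.intro)
  show "tree_auto A \<subseteq> carrier (BijGroup (lists A))"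
    by (auto simp: tree_auto_def BijGroup_def)
next
  fix f g assume fg: "f \<in> tree_auto A" "g \<in> tree_auto A"
  then have B: "f \<in> Bij (lists A)" "g \<in> Bij (lists A)"
    and pf: "\<And>u v. u \<in> lists A \<Longrightarrow> v \<in> lists A \<Longrightarrow> prefix (f u) (f v) \<longleftrightarrow> prefix u v"
    and pg: "\<And>u v. u \<in> lists A \<Longrightarrow> v \<in> lists A \<Longrightarrow> prefix (g u) (g v) \<longleftrightarrow> prefix u v"
    unfolding tree_auto_def by blast+
  have g: "g u \<in> lists A" if "u \<in> lists A" for u
    using that Bij_imp_funcset[OF B(2)] by blast
  have "compose (lists A) f g \<in> tree_auto A"
    unfolding tree_auto_def
  proof (intro CollectI conjI ballI)
    show "compose (lists A) f g \<in> Bij (lists A)" by (rule compose_Bij[OF B])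
  next
    fix u v assume uv: "u \<in> lists A" "v \<in> lists A"
    show "prefix (compose (lists A) f g u) (compose (lists A) f g v) \<longleftrightarrow> prefix u v"
      unfolding compose_eq[OF uv(1)] compose_eq[OF uv(2)] pf[OF g[OF uv(1)] g[OF uv(2)]]
      by (rule pg[OF uv])
  qed
  then show "f \<otimes>\<^bsub>BijGroup (lists A)\<^esub> g \<in> tree_auto A"
    using B by (simp add: BijGroup_def)
next
  show "\<one>\<^bsub>BijGroup (lists A)\<^esub> \<in> tree_auto A"
    by (simp add: tree_auto_def BijGroup_def id_Bij)
next
  fix f assume f: "f \<in> tree_auto A"
  then have B: "f \<in> Bij (lists A)"
    and pf: "\<And>u v. u \<in> lists A \<Longrightarrow> v \<in> lists A \<Longrightarrow> prefix (f u) (f v) \<longleftrightarrow> prefix u v"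
    unfolding tree_auto_def by blast+
  let ?g = "inv_into (lists A) f"
  have im: "f ` lists A = lists A" using B unfolding Bij_def bij_betw_def by blast
  have g: "?g u \<in> lists A" "f (?g u) = u" if "u \<in> lists A" for u
    using Bij_inv_into_mem[OF B that] f_inv_into_f[of u f "lists A"] that unfolding im by blast+
  have "restrict ?g (lists A) \<in> tree_auto A"
    unfolding tree_auto_def
  proof (intro CollectI conjI ballI)
    show "restrict ?g (lists A) \<in> Bij (lists A)" by (rule restrict_inv_into_Bij[OF B])
  next
    fix u v assume uv: "u \<in> lists A" "v \<in> lists A"
    show "prefix (restrict ?g (lists A) u) (restrict ?g (lists A) v) \<longleftrightarrow> prefix u v"
      unfolding restrict_apply'[OF uv(1)] restrict_apply'[OF uv(2)]
      using pf[OF g(1)[OF uv(1)] g(1)[OF uv(2)]] unfolding g(2)[OF uv(1)] g(2)[OF uv(2)] by blast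
  qed
  then show "inv\<^bsub>BijGroup (lists A)\<^esub> f \<in> tree_auto A"
    unfolding inv_BijGroup[OF B] .
qed

lemma group_Tree_AutoGroup: "group (Tree_AutoGroup A)"
  unfolding Tree_AutoGroup_def
  by (rule subgroup.subgroup_is_group[OF subgroup_tree_auto group_BijGroup])

section \<open>The group generated by an invertible transducer\<close>

definition state_action :: "('q, 'a) transducer \<Rightarrow> 'q \<Rightarrow> 'a list \<Rightarrow> 'a list" where
  "state_action T q = restrict (transduce T q) (lists (alphabet T))"

text \<open>
  \<^const>\<open>subgroup_generated\<close> discards generators outside the carrier; by the lemma
  \<open>state_action_tree_auto\<close> below, nothing is discarded when \<open>T\<close> is invertible.
\<close>

definition transducer_group :: "('q, 'a) transducer \<Rightarrow> ('a list \<Rightarrow> 'a list) monoid" where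
  "transducer_group T =
     subgroup_generated (Tree_AutoGroup (alphabet T)) (state_action T ` states T)"

lemma (in finite_transducer) transduce_closed:
  "q \<in> states T \<Longrightarrow> w \<in> lists (alphabet T) \<Longrightarrow> transduce T q w \<in> lists (alphabet T)"
  by (induction w arbitrary: q) (auto simp: out_closed nxt_closed)

lemma (in invertible_transducer) transduce_prefix_iff:
  "\<lbrakk>q \<in> states T; u \<in> lists (alphabet T); v \<in> lists (alphabet T)\<rbrakk>
    \<Longrightarrow> prefix (transduce T q u) (transduce T q v) \<longleftrightarrow> prefix u v"
proof (induction u arbitrary: q v)
  case Nil
  then show ?case by simp
next
  case (Cons a u)
  show ?case
  proof (cases v)
    case Nil
    then show ?thesis by simp
  next
    case v: (Cons b v')
    have "out T q a = out T q b \<longleftrightarrow> a = b"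
      using Cons.prems v out_bij[of q] by (auto simp: bij_betw_def inj_on_def)
    moreover have "prefix (transduce T (nxt T q a) u) (transduce T (nxt T q a) v') \<longleftrightarrow> prefix u v'"
      by (rule Cons.IH) (use Cons.prems v nxt_closed in auto)
    ultimately show ?thesis using v by auto
  qed
qed

lemma (in invertible_transducer) transduce_surj:
  "q \<in> states T \<Longrightarrow> w \<in> lists (alphabet T) \<Longrightarrow> \<exists>u\<in>lists (alphabet T). transduce T q u = w"
proof (induction w arbitrary: q)
  case Nil
  show ?case by (rule bexI[of _ "[]"]) auto
next
  case (Cons b w)
  then obtain a where a: "a \<in> alphabet T" "out T q a = b"
    using out_bij[OF Cons.prems(1)] Cons.prems(2) unfolding bij_betw_def by (metis Cons_in_lists_iff imageE)
  obtain u where "u \<in> lists (alphabet T)" "transduce T (nxt T q a) u = w"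
    using Cons.IH[OF nxt_closed[OF Cons.prems(1) a(1)]] Cons.prems(2) by auto
  with a show ?case by (intro bexI[of _ "a # u"]) auto
qed

lemma (in invertible_transducer) state_action_tree_auto:
  assumes "q \<in> states T"
  shows "state_action T q \<in> tree_auto (alphabet T)"
proof -
  have "inj_on (transduce T q) (lists (alphabet T))"
  proof (rule inj_onI)
    fix u v assume uv: "u \<in> lists (alphabet T)" "v \<in> lists (alphabet T)"
      and eq: "transduce T q u = transduce T q v"
    have "prefix u v" "prefix v u"
      using transduce_prefix_iff[OF assms uv] transduce_prefix_iff[OF assms uv(2,1)] eq by simp_all
    then show "u = v" by (rule prefix_order.antisym)
  qed
  moreover have "transduce T q ` lists (alphabet T) = lists (alphabet T)"
    using transduce_closed[OF assms] transduce_surj[OF assms] by blast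
  ultimately have "state_action T q \<in> Bij (lists (alphabet T))"
    unfolding Bij_def bij_betw_def state_action_def by (simp add: inj_on_restrict_eq)
  then show ?thesis
    using transduce_prefix_iff[OF assms] by (simp add: tree_auto_def state_action_def)
qed

section \<open>Dual transducers and the identity Cayley machine\<close>

text \<open>The edge from \<open>p\<close> to \<open>q\<close> labelled \<open>a|b\<close> becomes an edge from \<open>a\<close> to \<open>b\<close> labelled \<open>p|q\<close>.\<close>

definition dual_transducer :: "('q, 'a) transducer \<Rightarrow> ('a, 'q) transducer" where
  "dual_transducer T =
     \<lparr>states = alphabet T, alphabet = states T,
      out = (\<lambda>a p. nxt T p a), nxt = (\<lambda>a p. out T p a)\<rparr>"

definition identity_cayley_machine :: "('g, 'b) monoid_scheme \<Rightarrow> ('g, 'g) transducer" where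
  "identity_cayley_machine G =
     \<lparr>states = carrier G, alphabet = carrier G,
      out = (\<lambda>g x. x), nxt = (\<lambda>g x. g \<otimes>\<^bsub>G\<^esub> x)\<rparr>"

lemma (in finite_transducer) finite_transducer_dual: "finite_transducer (dual_transducer T)"
  by unfold_locales
    (auto simp: dual_transducer_def finite_states finite_alphabet out_closed nxt_closed)

lemma (in group) finite_transducer_identity_cayley_machine:
  "finite (carrier G) \<Longrightarrow> finite_transducer (identity_cayley_machine G)"
  by unfold_locales (auto simp: identity_cayley_machine_def)

lemma (in group) invertible_dual_identity_cayley_machine:
  assumes "finite (carrier G)"
  shows "invertible_transducer (dual_transducer (identity_cayley_machine G))"
proof -
  interpret D: finite_transducer "dual_transducer (identity_cayley_machine G)"
    using finite_transducer_identity_cayley_machine[OF assms]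
    by (rule finite_transducer.finite_transducer_dual)
  show ?thesis
  proof unfold_locales
    fix x assume "x \<in> states (dual_transducer (identity_cayley_machine G))"
    then have x: "x \<in> carrier G"
      by (simp add: dual_transducer_def identity_cayley_machine_def)
    have "bij_betw (\<lambda>g. g \<otimes> x) (carrier G) (carrier G)"
      by (rule bij_betw_byWitness[where f' = "\<lambda>g. g \<otimes> inv x"]) (auto simp: x m_assoc)
    then show "bij_betw (out (dual_transducer (identity_cayley_machine G)) x)
        (alphabet (dual_transducer (identity_cayley_machine G)))
        (alphabet (dual_transducer (identity_cayley_machine G)))"
      by (simp add: dual_transducer_def identity_cayley_machine_def)
  qed
qed

end

theory Submission
  imports Defs
begin

text \<open>
  In the dual of the identity Cayley machine the state \<open>x\<close> loops on every input letter and turns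
  the letter \<open>g\<close> into \<open>g \<otimes> x\<close>. It therefore acts on a word by right multiplication of every
  letter by \<open>x\<close>: the action is the diagonal right regular action of \<open>G\<close> on words. Composing
  the actions of \<open>x\<close> and \<open>y\<close> (first \<open>y\<close>, then \<open>x\<close>) gives the action of \<open>y \<otimes> x\<close>, so sending
  \<open>x\<close> to the action of \<open>inv x\<close> is a homomorphism from \<open>G\<close> to the automorphism group of the
  tree. Its image consists of all state actions, so these already form a subgroup and the group
  they generate contains nothing else.

  Both claims now follow from the freeness of right multiplication. If the action of \<open>x\<close> fixes a
  nonempty word, then looking at the first letter \<open>g\<close> gives \<open>g \<otimes> x = g\<close>, hence \<open>x = \<one>\<close>. This
  is triviality of the stabilizers; applied to the word with the single letter \<open>\<one>\<close> it makes the
  homomorphism injective, hence an isomorphism onto the generated group.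
\<close>

context group
begin

abbreviation dual_act :: "'a \<Rightarrow> 'a list \<Rightarrow> 'a list" where
  "dual_act \<equiv> state_action (dual_transducer (identity_cayley_machine G))"

lemma transduce_dual_cayley:
  "transduce (dual_transducer (identity_cayley_machine G)) x w = map (\<lambda>g. g \<otimes> x) w"
  by (induction w) (simp_all add: dual_transducer_def identity_cayley_machine_def)

lemma alphabet_dual_cayley: "alphabet (dual_transducer (identity_cayley_machine G)) = carrier G"
  and states_dual_cayley: "states (dual_transducer (identity_cayley_machine G)) = carrier G"
  by (simp_all add: dual_transducer_def identity_cayley_machine_def)

lemma dual_act_eq_map:
  assumes "w \<in> lists (carrier G)"
  shows "dual_act x w = map (\<lambda>g. g \<otimes> x) w"
  using assms by (simp add: state_action_def transduce_dual_cayley alphabet_dual_cayley)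

lemma dual_act_mult:
  assumes "x \<in> carrier G" "y \<in> carrier G"
  shows "compose (lists (carrier G)) (dual_act x) (dual_act y) = dual_act (y \<otimes> x)"
proof (rule extensionalityI)
  fix w assume w: "w \<in> lists (carrier G)"
  have "map (\<lambda>g. g \<otimes> y) w \<in> lists (carrier G)"
    using w assms by auto
  moreover have "map (\<lambda>g. g \<otimes> x) (map (\<lambda>g. g \<otimes> y) w) = map (\<lambda>g. g \<otimes> (y \<otimes> x)) w"
    using w assms by (auto simp: m_assoc)
  ultimately show
    "compose (lists (carrier G)) (dual_act x) (dual_act y) w = dual_act (y \<otimes> x) w"
    using w by (simp add: compose_eq dual_act_eq_map del: map_map)
next
  show "dual_act (y \<otimes> x) \<in> extensional (lists (carrier G))"
    by (simp add: state_action_def alphabet_dual_cayley)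
qed (rule compose_extensional)

text \<open>
  Cancellation in the first letter of \<open>w\<close> alone forces \<open>x = \<one>\<close>. Both the injectivity of the
  representation and the triviality of stabilizers come from this freeness.
\<close>

lemma dual_act_fixes_iff:
  assumes "x \<in> carrier G" "w \<in> lists (carrier G)" "w \<noteq> []"
  shows "dual_act x w = w \<longleftrightarrow> x = \<one>"
proof
  assume fixed: "dual_act x w = w"
  obtain g u where w: "w = g # u" using assms(3) by (cases w) auto
  have "g \<otimes> x = g"
    using fixed unfolding dual_act_eq_map[OF assms(2)] by (simp add: w)
  then show "x = \<one>" using assms(1,2) w by simp
next
  assume "x = \<one>"
  then show "dual_act x w = w"
    unfolding dual_act_eq_map[OF assms(2)] using assms(2) by (auto intro: map_idI)
qed

text \<open>
  Composition applies its right argument first, which would make \<open>dual_act\<close> itself an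
  antihomomorphism; the inverse restores the order.
\<close>

lemma dual_act_inv_hom:
  assumes "finite (carrier G)"
  shows "group_hom G (Tree_AutoGroup (carrier G)) (\<lambda>x. dual_act (inv x))"
proof -
  interpret D: invertible_transducer "dual_transducer (identity_cayley_machine G)"
    by (rule invertible_dual_identity_cayley_machine[OF assms])
  have auto: "dual_act x \<in> tree_auto (carrier G)" if "x \<in> carrier G" for x
    using D.state_action_tree_auto[of x] that
    by (simp add: states_dual_cayley alphabet_dual_cayley)
  then have Bij: "dual_act x \<in> Bij (lists (carrier G))" if "x \<in> carrier G" for x
    using that by (auto simp: tree_auto_def)
  show ?thesis
    by (intro group_hom.intro group_hom_axioms.intro group_axioms group_Tree_AutoGroup homI)
      (simp_all add: Tree_AutoGroup_def BijGroup_def auto Bij dual_act_mult inv_mult_group)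
qed

text \<open>
  The state actions are the image of the homomorphism above, since inversion permutes \<open>G\<close>; so
  they form a subgroup and generate only themselves.
\<close>

lemma carrier_transducer_group_dual_cayley:
  assumes "finite (carrier G)"
  shows "carrier (transducer_group (dual_transducer (identity_cayley_machine G)))
    = (\<lambda>x. dual_act (inv x)) ` carrier G"
proof -
  interpret hom: group_hom G "Tree_AutoGroup (carrier G)" "\<lambda>x. dual_act (inv x)"
    by (rule dual_act_inv_hom[OF assms])
  have "dual_act ` carrier G = (\<lambda>x. dual_act (inv x)) ` carrier G"
  proof (intro equalityI image_subsetI)
    fix x assume "x \<in> carrier G"
    then show "dual_act x \<in> (\<lambda>x. dual_act (inv x)) ` carrier G"
      by (intro image_eqI[of _ _ "inv x"]) simp_all
  qed simp
  then show ?thesis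
    using subgroup.carrier_subgroup_generated_subgroup[OF hom.img_is_subgroup]
    by (simp add: transducer_group_def states_dual_cayley alphabet_dual_cayley)
qed

lemma transducer_group_dual_cayley_iso:
  assumes "finite (carrier G)"
  shows "transducer_group (dual_transducer (identity_cayley_machine G)) \<cong> G"
proof -
  let ?K = "transducer_group (dual_transducer (identity_cayley_machine G))"
  let ?h = "\<lambda>x. dual_act (inv x)"
  interpret hom: group_hom G "Tree_AutoGroup (carrier G)" ?h
    by (rule dual_act_inv_hom[OF assms])
  note carrier_K = carrier_transducer_group_dual_cayley[OF assms]
  have "inj_on ?h (carrier G)"
    unfolding hom.inj_on_one_iff
  proof (intro allI impI)
    fix x assume x: "x \<in> carrier G" and "?h x = \<one>\<^bsub>Tree_AutoGroup (carrier G)\<^esub>"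
    then have "?h x [\<one>] = [\<one>]"
      by (simp add: Tree_AutoGroup_def BijGroup_def)
    then show "x = \<one>"
      using dual_act_fixes_iff[of "inv x" "[\<one>]"] x by simp
  qed
  moreover have "?h \<in> hom G ?K"
  proof (rule homI)
    fix x y assume "x \<in> carrier G" "y \<in> carrier G"
    then have "?h (x \<otimes> y) = ?h x \<otimes>\<^bsub>Tree_AutoGroup (carrier G)\<^esub> ?h y"
      by (rule hom.hom_mult)
    then show "?h (x \<otimes> y) = ?h x \<otimes>\<^bsub>?K\<^esub> ?h y"
      by (simp add: transducer_group_def alphabet_dual_cayley)
  qed (simp add: carrier_K)
  ultimately have "?h \<in> iso G ?K"
    unfolding iso_def bij_betw_def carrier_K by blast
  then show ?thesis
    by (rule iso_sym[OF is_isoI])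
qed

lemma stabilizer_dual_cayley:
  assumes "finite (carrier G)" "w \<in> lists (carrier G)" "w \<noteq> []"
  defines "K \<equiv> transducer_group (dual_transducer (identity_cayley_machine G))"
  shows "stabilizer K (\<lambda>f. f) w = {\<one>\<^bsub>K\<^esub>}"
proof -
  let ?h = "\<lambda>x. dual_act (inv x)"
  interpret hom: group_hom G "Tree_AutoGroup (carrier G)" ?h
    by (rule dual_act_inv_hom[OF assms(1)])
  have one_K: "\<one>\<^bsub>K\<^esub> = ?h \<one>"
    unfolding hom.hom_one by (simp add: K_def transducer_group_def alphabet_dual_cayley)
  have "stabilizer K (\<lambda>f. f) w = ?h ` {x \<in> carrier G. ?h x w = w}"
    unfolding stabilizer_def K_def carrier_transducer_group_dual_cayley[OF assms(1)] by blast
  also have "{x \<in> carrier G. ?h x w = w} = {\<one>}"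
    using dual_act_fixes_iff[OF inv_closed assms(2,3)] by auto
  finally show ?thesis
    unfolding one_K by blast
qed

end

theorem proposition14:
  fixes G :: "('g, 'b) monoid_scheme"
  assumes "group G" and "finite (carrier G)"
  shows "let K = transducer_group (dual_transducer (identity_cayley_machine G)) in
    K \<cong> G \<and>
    (\<forall>w \<in> lists (carrier G). w \<noteq> [] \<longrightarrow> stabilizer K (\<lambda>f. f) w = {\<one>\<^bsub>K\<^esub>})"
proof -
  interpret group G by fact
  show ?thesis
    using transducer_group_dual_cayley_iso[OF assms(2)] stabilizer_dual_cayley[OF assms(2)]
    by (simp add: Let_def)
qed

end
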